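(* For a positive integer $n$, let $r_3(n)$ denote the product of all primes congruent to $3$ modulo $4$ which divide the square-free part of $n$. Let $n,m$ be positive integers and $x,y$ nonzero integers. The quadratic forms $\langle n, x^2 n\rangle$ and $\langle m, y^2 m\rangle$ are similar over $\mathbb{Q}$ if and only if $r_3(n)=r_3(m)$.
   Context: $\langle a_1,\dots,a_k\rangle$ denotes the quadratic form on $\mathbb{Q}^k$ with matrix $\mathrm{diag}(a_1,\dots,a_k)$. Two quadratic forms with symmetric matrices $Q_1,Q_2$ are similar (over $\mathbb{Q}$) if there is an invertible rational matrix $A$ with $A^{\top}Q_2A=Q_1$. The square-free part of a positive integer $n$ is the square-free integer $s$ with $n=sr^2$ for an integer $r$. *)

theory Defs
  imports "HOL-Analysis.Analysis" "HOL-Computational_Algebra.Squarefree"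
begin

definition form_of_matrix :: "rat ^ 'n ^ 'n \<Rightarrow> rat ^ 'n \<Rightarrow> rat" where
  "form_of_matrix Q v = (\<Sum>i\<in>UNIV. v $ i * (Q *v v) $ i)"

definition diag_matrix :: "rat ^ 'n \<Rightarrow> rat ^ 'n ^ 'n" where
  "diag_matrix a = (\<chi> i j. if i = j then a $ i else 0)"

definition diag_form :: "rat ^ 'n \<Rightarrow> rat ^ 'n \<Rightarrow> rat" where
  "diag_form a = form_of_matrix (diag_matrix a)"

(* A quadratic form over the rationals has exactly one symmetric matrix, so the
   quantifiers over Q1 and Q2 only name the matrices of q1 and q2. *)
definition similar_forms :: "(rat ^ 'n \<Rightarrow> rat) \<Rightarrow> (rat ^ 'n \<Rightarrow> rat) \<Rightarrow> bool" where
  "similar_forms q1 q2 \<longleftrightarrow>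
     (\<exists>Q1 Q2. transpose Q1 = Q1 \<and> transpose Q2 = Q2 \<and>
        q1 = form_of_matrix Q1 \<and> q2 = form_of_matrix Q2 \<and>
        (\<exists>A :: rat ^ 'n ^ 'n. invertible A \<and> transpose A ** Q2 ** A = Q1))"

definition r3 :: "nat \<Rightarrow> nat" where
  "r3 n = \<Prod>{p. prime p \<and> p mod 4 = 3 \<and> p dvd squarefree_part n}"

end

(* The first basis vector represents n, so a similarity yields n = m (a^2 + y^2 c^2) with rational
   a and c. Hence n m is a sum of two rational squares; conversely the vector (a, c) extends to a
   similarity by an orthogonal vector of the right length. A positive integer is a sum of two
   rational squares iff every prime congruent to 3 modulo 4 divides it to an even power, and for
   n m this says that n and m have the same such primes in their square-free parts. *)

theory Submission
  imports Defs "HOL-Number_Theory.Euler_Criterion" "HOL-Library.Discrete_Functions"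
begin

section \<open>Sums of two integer squares\<close>

text \<open>If \<open>p\<close> did not divide \<open>s\<close>, then \<open>t / s\<close> would be
  a square root of -1 modulo \<open>p\<close>, which Euler's criterion excludes for primes congruent
  to 3 modulo 4.\<close>

lemma prime_3_mod_4_dvd_sum_squares:
  fixes p :: nat and s t :: int
  assumes p: "prime p" "p mod 4 = 3" and dvd: "int p dvd s\<^sup>2 + t\<^sup>2"
  shows "int p dvd s"
proof (rule ccontr)
  assume s: "\<not> int p dvd s"
  have pi: "prime (int p)" using p by simp
  have t: "\<not> int p dvd t"
  proof
    assume "int p dvd t"
    then have "int p dvd t\<^sup>2" by (simp add: power2_eq_square)
    then have "int p dvd s\<^sup>2" using dvd by (simp add: dvd_add_left_iff)
    then show False using s pi prime_dvd_power by blast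
  qed
  have p2: "p > 2" using p prime_gt_1_nat[of p] by (cases "p = 2") auto
  \<comment> \<open>The inverse \<open>r\<close> of \<open>s\<close> modulo \<open>p\<close> makes
    \<open>t * r\<close> the desired root of -1.\<close>
  have "coprime s (int p)" 
    using s pi by (metis coprime_commute prime_imp_coprime)
  then obtain r where r: "[s * r = 1] (mod int p)"
    using cong_solve_coprime_int by blast
  have "[(t * r)\<^sup>2 + 1 = r\<^sup>2 * (s\<^sup>2 + t\<^sup>2)] (mod int p)"
  proof -
    have "[(s * r)\<^sup>2 + (t * r)\<^sup>2 = 1\<^sup>2 + (t * r)\<^sup>2] (mod int p)"
      by (intro cong_add cong_pow r cong_refl)
    then show ?thesis by (simp add: power_mult_distrib algebra_simps cong_sym)
  qed
  moreover have "[r\<^sup>2 * (s\<^sup>2 + t\<^sup>2) = 0] (mod int p)"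
    using dvd by (simp add: cong_0_iff)
  ultimately have "[(t * r)\<^sup>2 + 1 = 0] (mod int p)" using cong_trans by blast
  then have "[(t * r)\<^sup>2 = -1] (mod int p)" by (simp add: cong_iff_dvd_diff)
  then have "QuadRes (int p) (-1)" unfolding QuadRes_def by blast
  moreover have "\<not> [-1 = 0] (mod int p)"
    using p2 by (simp add: cong_iff_dvd_diff)
  ultimately have "Legendre (-1) (int p) = 1" by (simp add: Legendre_def)
  moreover have "[Legendre (-1) (int p) = (-1) ^ ((p - 1) div 2)] (mod int p)"
    using euler_criterion p p2 by blast
  moreover have "odd ((p - 1) div 2)" using p(2) by presburger
  ultimately have "[1 = -1] (mod int p)" by simp
  then have "int p dvd 2" by (simp add: cong_iff_dvd_diff)
  then show False using p2 zdvd_imp_le[of "int p" 2] by simp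
qed

text \<open>Descent: a prime \<open>p\<close> of this kind that divides \<open>N\<close> divides
  both \<open>s\<close> and \<open>t\<close>. Cancelling \<open>p^2\<close> leaves a smaller sum of
  two squares and lowers the multiplicity by exactly 2.\<close>

lemma even_multiplicity_sum_squares:
  fixes p N :: nat and s t :: int
  assumes p: "prime p" "p mod 4 = 3" and "int N = s\<^sup>2 + t\<^sup>2" "N > 0"
  shows "even (multiplicity p N)"
  using assms(3,4)
proof (induction N arbitrary: s t rule: less_induct)
  case (less N)
  show ?case
  proof (cases "p dvd N")
    case False
    then show ?thesis by (simp add: not_dvd_imp_multiplicity_0)
  next
    case True
    then have "int p dvd s\<^sup>2 + t\<^sup>2" using less.prems(1) by (metis of_nat_dvd_iff)
    then have "int p dvd s" "int p dvd t"
      using prime_3_mod_4_dvd_sum_squares[OF p, of s t] prime_3_mod_4_dvd_sum_squares[OF p, of t s]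
      by (simp_all add: add.commute)
    then obtain s' t' where st: "s = int p * s'" "t = int p * t'" by (auto elim!: dvdE)
    define M where "M = nat (s'\<^sup>2 + t'\<^sup>2)"
    have M: "int M = s'\<^sup>2 + t'\<^sup>2" unfolding M_def by simp
    have "int N = int (p\<^sup>2 * M)" 
      by (simp add: less.prems(1) st M algebra_simps power_mult_distrib)
    then have N: "N = p\<^sup>2 * M" by (simp only: of_nat_eq_iff)
    have M0: "M > 0" using N less.prems(2) by (cases M) auto
    have p1: "p > 1" using p prime_gt_1_nat by blast
    then have "1 * M < p\<^sup>2 * M" using M0 one_less_power[OF p1, of 2] by simp
    then have "even (multiplicity p M)" using less.IH[OF _ M M0] N by simp
    moreover have "multiplicity p N = 2 + multiplicity p M"
      using N M0 p p1 by (simp add: prime_elem_multiplicity_mult_distrib)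
    ultimately show ?thesis by simp
  qed
qed

text \<open>Thue's argument: the residues of \<open>u - i v\<close> with \<open>0 \<le> u, v \<le> \<lfloor>\<surd>p\<rfloor>\<close> cannot be distinct modulo
  \<open>p\<close>, and a coincidence yields \<open>a\<^sup>2 + b\<^sup>2\<close> divisible by \<open>p\<close> and strictly between \<open>0\<close> and \<open>2 p\<close>.\<close>

lemma prime_1_mod_4_sum_squares:
  fixes p :: nat
  assumes p: "prime p" "p mod 4 = 1"
  shows "\<exists>a b :: int. int p = a\<^sup>2 + b\<^sup>2"
proof -
  have p2: "p > 2" using p prime_gt_1_nat[of p] by (cases "p = 2") auto
  have "[Legendre (-1) (int p) = (-1) ^ ((p - 1) div 2)] (mod int p)"
    using euler_criterion p p2 by blast
  moreover have "even ((p - 1) div 2)" using p(2) by presburger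
  ultimately have "[Legendre (-1) (int p) = 1] (mod int p)" by simp
  \<comment> \<open>The other values 0 and -1 of the Legendre symbol are not congruent to 1 modulo
    \<open>p\<close>, since \<open>p > 2\<close>.\<close>
  then have "QuadRes (int p) (-1)"
    using p2 zdvd_imp_le[of "int p" 2]
    by (auto simp: Legendre_def cong_iff_dvd_diff split: if_splits)
  then obtain i where "[i\<^sup>2 = -1] (mod int p)" unfolding QuadRes_def by blast
  then have i: "int p dvd i\<^sup>2 + 1" by (simp add: cong_iff_dvd_diff)
  define k where "k = floor_sqrt p"
  define f where "f = (\<lambda>(u, v). (int u - i * int v) mod int p)"
  let ?S = "{0..k} \<times> {0..k}"
  have "f ` ?S \<subseteq> {0..<int p}" using p2 by (auto simp: f_def)
  then have "card (f ` ?S) \<le> card {0..<int p}" by (intro card_mono) auto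
  also have "\<dots> = p" by simp
  also have "p < card ?S"
    using Suc_floor_sqrt_power2_gt[of p] by (simp add: k_def power2_eq_square)
  finally have "\<not> inj_on f ?S" by (rule pigeonhole)
  then obtain u v u' v' where uv: "u \<le> k" "v \<le> k" "u' \<le> k" "v' \<le> k" "(u, v) \<noteq> (u', v')"
    and eq: "f (u, v) = f (u', v')"
    unfolding inj_on_def by auto
  define a where "a = int u - int u'"
  define b where "b = int v - int v'"
  have "int p dvd (int u - i * int v) - (int u' - i * int v')"
    using eq by (simp add: f_def mod_eq_dvd_iff)
  then have "int p dvd a - i * b" by (simp add: a_def b_def algebra_simps)
  \<comment> \<open>The product with the conjugate is \<open>a^2 - i^2 b^2\<close>; the added
    multiple of \<open>i^2 + 1\<close> replaces \<open>- i^2\<close> by 1.\<close>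
  then have "int p dvd (a - i * b) * (a + i * b) + (i\<^sup>2 + 1) * b\<^sup>2" using i by simp
  also have "(a - i * b) * (a + i * b) + (i\<^sup>2 + 1) * b\<^sup>2 = a\<^sup>2 + b\<^sup>2"
    by (simp add: algebra_simps power2_eq_square)
  finally have dvd: "int p dvd a\<^sup>2 + b\<^sup>2" .
  \<comment> \<open>A prime is not a perfect square. The resulting strict bound
    \<open>k^2 < p\<close> is what keeps \<open>a^2 + b^2\<close> below \<open>2 p\<close>, so that
    it can only be \<open>p\<close> itself.\<close>
  have "k\<^sup>2 \<noteq> p"
    using p(1) by (auto simp: prime_power_iff)
  then have k: "k\<^sup>2 < p" using floor_sqrt_power2_le[of p] unfolding k_def by linarith
  have "\<bar>a\<bar> \<le> int k" "\<bar>b\<bar> \<le> int k" using uv by (auto simp: a_def b_def)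
  then have "a\<^sup>2 \<le> (int k)\<^sup>2" "b\<^sup>2 \<le> (int k)\<^sup>2" 
    using abs_le_square_iff[of a "int k"] abs_le_square_iff[of b "int k"] by simp_all
  moreover have "(int k)\<^sup>2 < int p" using k by (simp flip: of_nat_power)
  ultimately have lt: "a\<^sup>2 + b\<^sup>2 < 2 * int p" by linarith
  have "a \<noteq> 0 \<or> b \<noteq> 0" using uv by (auto simp: a_def b_def)
  then have pos: "a\<^sup>2 + b\<^sup>2 > 0" by (simp add: sum_power2_gt_zero_iff)
  obtain c where c: "a\<^sup>2 + b\<^sup>2 = int p * c" using dvd by (elim dvdE)
  have "c > 0" using pos c p2 by (simp add: zero_less_mult_iff)
  moreover have "c < 2" using lt c p2 by (simp add: mult.commute)
  ultimately have "c = 1" by simp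
  then have "int p = a\<^sup>2 + b\<^sup>2" using c by simp
  then show ?thesis by blast
qed

text \<open>Induction by removing prime factors. A prime congruent to 3 modulo 4 is removed in
  pairs, and \<open>p^2\<close> is absorbed by scaling both squares. Any other prime is itself a sum
  of two squares, and such sums are closed under products.\<close>

lemma sum_squares_of_even_multiplicity:
  fixes N :: nat
  assumes "N > 0" "\<And>p. prime p \<Longrightarrow> p mod 4 = 3 \<Longrightarrow> even (multiplicity p N)"
  shows "\<exists>s t :: int. int N = s\<^sup>2 + t\<^sup>2"
  using assms
proof (induction N rule: less_induct)
  case (less N)
  show ?case
  proof (cases "N = 1")
    case True
    then have "int N = 1\<^sup>2 + 0\<^sup>2" by simp
    then show ?thesis by blast
  next
    case False
    then obtain p where p: "prime p" "p dvd N" using prime_factor_nat by blast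
    have p1: "p > 1" using p prime_gt_1_nat by blast
    show ?thesis
    proof (cases "p mod 4 = 3")
      case True
      have "multiplicity p N \<noteq> 0" using p p1 less.prems(1) by (simp add: multiplicity_eq_zero_iff)
      then have "multiplicity p N \<ge> 2" using less.prems(2)[OF p(1) True] by presburger
      then obtain M where M: "N = p\<^sup>2 * M" using multiplicity_dvd' by (metis dvdE)
      have M0: "M > 0" using M less.prems(1) by (cases M) auto
      have "1 * M < p\<^sup>2 * M" using M0 one_less_power[OF p1, of 2] by simp
      moreover have "even (multiplicity q M)" if q: "prime q" "q mod 4 = 3" for q
        using less.prems(2)[OF q] M M0 p1 q
        by (simp add: prime_elem_multiplicity_mult_distrib prime_elem_multiplicity_power_distrib)
      ultimately obtain s t :: int where "int M = s\<^sup>2 + t\<^sup>2" using less.IH[OF _ M0] M by auto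
      then have "int N = (int p * s)\<^sup>2 + (int p * t)\<^sup>2"
        by (simp add: M power_mult_distrib algebra_simps)
      then show ?thesis by blast
    next
      case False
      have "\<exists>a b :: int. int p = a\<^sup>2 + b\<^sup>2"
      proof (cases "p = 2")
        case True
        then have "int p = 1\<^sup>2 + 1\<^sup>2" by simp
        then show ?thesis by blast
      next
        case False
        then have "odd p" using p p1 prime_odd_nat[of p] by simp
        then have "p mod 4 = 1" using \<open>p mod 4 \<noteq> 3\<close> by presburger
        then show ?thesis using prime_1_mod_4_sum_squares p by blast
      qed
      then obtain a b :: int where ab: "int p = a\<^sup>2 + b\<^sup>2" by blast
      obtain M where M: "N = p * M" using p by (elim dvdE)
      have M0: "M > 0" using M less.prems(1) by (cases M) auto
      have "1 * M < p * M" using M0 p1 by simp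
      moreover have "even (multiplicity q M)" if q: "prime q" "q mod 4 = 3" for q
      proof -
        have "q \<noteq> p" using q False by auto
        then have "\<not> q dvd p" using q p primes_dvd_imp_eq by blast
        then show ?thesis using less.prems(2)[OF q] M M0 p1 q
          by (simp add: prime_elem_multiplicity_mult_distrib not_dvd_imp_multiplicity_0)
      qed
      ultimately obtain s t :: int where "int M = s\<^sup>2 + t\<^sup>2" using less.IH[OF _ M0] M by auto
      \<comment> \<open>Brahmagupta's identity: the norm of \<open>(a + b i) (s + t i)\<close> in
        the Gaussian integers.\<close>
      then have "int N = (a * s - b * t)\<^sup>2 + (a * t + b * s)\<^sup>2"
        by (simp add: M ab power2_eq_square algebra_simps)
      then show ?thesis by blast
    qed
  qed
qed

section \<open>Sums of two rational squares\<close>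

text \<open>Clearing denominators multiplies \<open>N\<close> by a square, which leaves the parity
  of every multiplicity unchanged, so the criterion for integer squares carries over to rational
  ones.\<close>

lemma rat_sum_squares_iff:
  fixes N :: nat
  assumes "N > 0"
  shows "(\<exists>u v :: rat. of_nat N = u\<^sup>2 + v\<^sup>2) \<longleftrightarrow>
         (\<forall>p. prime p \<longrightarrow> p mod 4 = 3 \<longrightarrow> even (multiplicity p N))"
proof (intro iffI allI impI)
  fix p :: nat
  assume p: "prime p" "p mod 4 = 3"
  assume "\<exists>u v :: rat. of_nat N = u\<^sup>2 + v\<^sup>2"
  then obtain u v :: rat where uv: "of_nat N = u\<^sup>2 + v\<^sup>2" by blast
  obtain s k where u: "u = Fract s k" "k > 0" by (cases u)
  obtain t l where v: "v = Fract t l" "l > 0" by (cases v)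
  define d where "d = nat (k * l)"
  have d: "int d = k * l" "d > 0" using u v by (simp_all add: d_def)
  have "of_nat N * (of_int (k * l) :: rat)\<^sup>2 = of_int ((s * l)\<^sup>2 + (t * k)\<^sup>2)"
    using u(2) v(2) by (simp add: uv u(1) v(1) Fract_of_int_quotient field_simps)
  then have "(of_int (int N * (k * l)\<^sup>2) :: rat) = of_int ((s * l)\<^sup>2 + (t * k)\<^sup>2)"
    by simp
  then have "int (N * d\<^sup>2) = (s * l)\<^sup>2 + (t * k)\<^sup>2"
    by (simp only: of_int_eq_iff of_nat_mult of_nat_power d)
  then have "even (multiplicity p (N * d\<^sup>2))"
    by (rule even_multiplicity_sum_squares[OF p]) (use assms d in simp)
  then show "even (multiplicity p N)"
    using p assms d 
    by (simp add: prime_elem_multiplicity_mult_distrib prime_elem_multiplicity_power_distrib)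
next
  assume "\<forall>p. prime p \<longrightarrow> p mod 4 = 3 \<longrightarrow> even (multiplicity p N)"
  then obtain s t :: int where st: "int N = s\<^sup>2 + t\<^sup>2"
    using sum_squares_of_even_multiplicity[OF assms] by blast
  have "(of_nat N :: rat) = of_int (int N)" by simp
  also have "\<dots> = (of_int s)\<^sup>2 + (of_int t)\<^sup>2" by (simp only: st of_int_add of_int_power)
  finally show "\<exists>u v :: rat. of_nat N = u\<^sup>2 + v\<^sup>2" by blast
qed

section \<open>\<open>r3\<close> in terms of parities of multiplicities\<close>

text \<open>The multiplicity of \<open>p\<close> in the square-free part is the multiplicity in
  \<open>n\<close> reduced modulo 2.\<close>

lemma prime_dvd_r3_iff:
  assumes "prime p"
  shows "p dvd r3 n \<longleftrightarrow> p mod 4 = 3 \<and> odd (multiplicity p n)"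
proof -
  let ?P = "{p. prime p \<and> p mod 4 = 3 \<and> p dvd squarefree_part n}"
  \<comment> \<open>The square-free part is never 0, so it has finitely many divisors; finiteness
    lets a prime that divides the product be traced to one of the factors.\<close>
  have fin: "finite ?P"
    by (rule finite_subset[OF _ finite_divisors_nat[of "squarefree_part n"]]) (auto intro: Nat.gr0I)
  have "p dvd r3 n \<longleftrightarrow> (\<exists>q\<in>?P. p dvd q)"
    unfolding r3_def using prime_dvd_prod_iff[OF fin assms, of "\<lambda>q. q"] by simp
  also have "\<dots> \<longleftrightarrow> p \<in> ?P" using assms by (auto dest: primes_dvd_imp_eq[OF assms])
  also have "\<dots> \<longleftrightarrow> p mod 4 = 3 \<and> multiplicity p (squarefree_part n) \<noteq> 0"
    using assms prime_gt_1_nat[OF assms] multiplicity_eq_zero_iff[of "squarefree_part n" p]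
    by simp
  also have "\<dots> \<longleftrightarrow> p mod 4 = 3 \<and> odd (multiplicity p n)"
    using assms by (simp add: prime_multiplicity_squarefree_part odd_iff_mod_2_eq_one)
  finally show ?thesis .
qed

text \<open>The prime divisors of \<open>r3 n\<close> determine it, so equality means that the
  multiplicities in \<open>n\<close> and \<open>m\<close> have equal parity at each prime congruent
  to 3 modulo 4. Multiplicities add up in \<open>n * m\<close>, and a sum is even iff its two terms
  have equal parity.\<close>

lemma r3_eq_iff:
  assumes "n > 0" "m > 0"
  shows "r3 n = r3 m \<longleftrightarrow>
         (\<forall>p. prime p \<longrightarrow> p mod 4 = 3 \<longrightarrow> even (multiplicity p (n * m)))"
proof -
  have "r3 n = r3 m \<longleftrightarrow>
        (\<forall>p. prime p \<longrightarrow> p mod 4 = 3 \<longrightarrow> (odd (multiplicity p n) \<longleftrightarrow> odd (multiplicity p m)))"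
  proof
    assume eq: "r3 n = r3 m"
    show "\<forall>p. prime p \<longrightarrow> p mod 4 = 3 \<longrightarrow>
        (odd (multiplicity p n) \<longleftrightarrow> odd (multiplicity p m))"
    proof (intro allI impI)
      fix p :: nat
      assume "prime p" "p mod 4 = 3"
      then show "odd (multiplicity p n) \<longleftrightarrow> odd (multiplicity p m)"
        using prime_dvd_r3_iff[of p n] prime_dvd_r3_iff[of p m] eq by simp
    qed
  next
    assume *: "\<forall>p. prime p \<longrightarrow> p mod 4 = 3 \<longrightarrow>
        (odd (multiplicity p n) \<longleftrightarrow> odd (multiplicity p m))"
    have "p dvd squarefree_part n \<longleftrightarrow> p dvd squarefree_part m" if "prime p" "p mod 4 = 3" for p
    proof -
      have "p dvd squarefree_part k \<longleftrightarrow> odd (multiplicity p k)" for k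
        using that multiplicity_eq_zero_iff[of "squarefree_part k" p]
        by (simp add: prime_multiplicity_squarefree_part even_iff_mod_2_eq_zero)
      then show ?thesis using * that by simp
    qed
    then have "{p. prime p \<and> p mod 4 = 3 \<and> p dvd squarefree_part n} =
               {p. prime p \<and> p mod 4 = 3 \<and> p dvd squarefree_part m}" by blast
    then show "r3 n = r3 m" by (simp add: r3_def)
  qed
  also have "\<dots> \<longleftrightarrow> (\<forall>p. prime p \<longrightarrow> p mod 4 = 3 \<longrightarrow> even (multiplicity p (n * m)))"
    using assms by (auto simp: prime_elem_multiplicity_mult_distrib)
  finally show ?thesis .
qed

section \<open>Similarity of binary diagonal forms\<close>

lemma form_of_matrix_congruence:
  "form_of_matrix (transpose A ** Q ** A) v = form_of_matrix Q (A *v v)"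
proof -
  have "form_of_matrix (transpose A ** Q ** A) v =
        (\<Sum>i\<in>UNIV. v $ i * (transpose A *v (Q *v (A *v v))) $ i)"
    by (simp add: form_of_matrix_def matrix_vector_mul_assoc matrix_mul_assoc)
  also have "\<dots> = (\<Sum>i\<in>UNIV. \<Sum>k\<in>UNIV. A $ k $ i * v $ i * (Q *v (A *v v)) $ k)"
    unfolding matrix_vector_mult_def[where m = "transpose A"]
    by (simp add: transpose_def sum_distrib_left mult_ac)
  also have "\<dots> = (\<Sum>k\<in>UNIV. \<Sum>i\<in>UNIV. A $ k $ i * v $ i * (Q *v (A *v v)) $ k)"
    by (rule sum.swap)
  also have "\<dots> = form_of_matrix Q (A *v v)"
    by (simp add: form_of_matrix_def matrix_vector_mult_def[where m = A] sum_distrib_right)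
  finally show ?thesis .
qed

lemma diag_form_2: "diag_form (vector [a, b] :: rat ^ 2) v = a * (v $ 1)\<^sup>2 + b * (v $ 2)\<^sup>2"
  by (simp add: diag_form_def form_of_matrix_def diag_matrix_def matrix_vector_mult_def sum_2
      power2_eq_square)

text \<open>Stated for values rather than matrices, so that it holds whichever symmetric matrices
  witness the similarity and can be tested on single vectors.\<close>

lemma similar_forms_imp_substitution:
  assumes "similar_forms q1 q2"
  obtains A where "\<And>v. q1 v = q2 (A *v v)"
  using assms unfolding similar_forms_def by (metis form_of_matrix_congruence)

lemma transpose_diag_matrix: "transpose (diag_matrix a) = diag_matrix a"
  by (simp add: transpose_def diag_matrix_def vec_eq_iff)

text \<open>Multiplied by \<open>m\<close>, a value \<open>m (a^2 + y^2 c^2)\<close> of the second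
  form becomes \<open>(m a)^2 + (m y c)^2\<close>. Hence \<open>n * m\<close> is a sum of two
  squares iff the second form represents \<open>n\<close>, and in dimension 2 a vector representing
  \<open>n\<close> determines a suitable orthogonal one.\<close>

lemma similar_forms_iff_sum_squares:
  fixes n m x y :: rat
  assumes "n \<noteq> 0" "m \<noteq> 0" "x \<noteq> 0" "y \<noteq> 0"
  shows "similar_forms (diag_form (vector [n, x\<^sup>2 * n] :: rat ^ 2))
                       (diag_form (vector [m, y\<^sup>2 * m] :: rat ^ 2))
         \<longleftrightarrow> (\<exists>u v. n * m = u\<^sup>2 + v\<^sup>2)"
    (is "similar_forms (diag_form ?a) (diag_form ?b) \<longleftrightarrow> _")
proof
  assume "similar_forms (diag_form ?a) (diag_form ?b)"
  then obtain A where A: "\<And>v. diag_form ?a v = diag_form ?b (A *v v)"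
    by (rule similar_forms_imp_substitution) blast
  \<comment> \<open>The first basis vector is sent to the first column of \<open>A\<close>.\<close>
  have "n = m * (A $ 1 $ 1)\<^sup>2 + y\<^sup>2 * m * (A $ 2 $ 1)\<^sup>2"
    using A[of "vector [1, 0]"] by (simp add: diag_form_2 matrix_vector_mult_def sum_2)
  then have "n * m = (m * (A $ 1 $ 1)\<^sup>2 + y\<^sup>2 * m * (A $ 2 $ 1)\<^sup>2) * m" by simp
  then have "n * m = (m * A $ 1 $ 1)\<^sup>2 + (m * y * A $ 2 $ 1)\<^sup>2"
    by (simp add: power2_eq_square algebra_simps)
  then show "\<exists>u v. n * m = u\<^sup>2 + v\<^sup>2" by blast
next
  assume "\<exists>u v. n * m = u\<^sup>2 + v\<^sup>2"
  then obtain u v where uv: "n * m = u\<^sup>2 + v\<^sup>2" by blast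
  \<comment> \<open>These coordinates invert the first direction: they solve \<open>u = m a\<close>
    and \<open>v = m y c\<close>.\<close>
  define a where "a = u / m"
  define c where "c = v / (m * y)"
  have n: "n = m * (a\<^sup>2 + y\<^sup>2 * c\<^sup>2)"
    using uv assms by (simp add: a_def c_def field_simps power2_eq_square)
  \<comment> \<open>The second column is \<open>x\<close> times the image of the first under \<open>(a, c) \<mapsto> (- y c, a / y)\<close>,
    an isometry of \<open>\<langle>1, y\<^sup>2\<rangle>\<close> that maps every vector to an orthogonal one.\<close>
  define A :: "rat ^ 2 ^ 2" where "A = vector [vector [a, - x * y * c], vector [c, x * a / y]]"
  \<comment> \<open>The determinant is \<open>(x / y) (a^2 + y^2 c^2)\<close>, and the second factor
    equals \<open>n / m\<close>.\<close>
  have "det A = x * n / (m * y)"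
    unfolding n using assms by (simp add: A_def det_2 field_simps power2_eq_square)
  then have "invertible A" using assms by (simp add: invertible_det_nz)
  moreover have "transpose A ** diag_matrix ?b ** A = diag_matrix ?a"
    unfolding n using assms
    by (simp add: A_def vec_eq_iff forall_2 matrix_matrix_mult_def sum_2 transpose_def
        diag_matrix_def field_simps power2_eq_square)
  ultimately show "similar_forms (diag_form ?a) (diag_form ?b)"
    unfolding similar_forms_def diag_form_def using transpose_diag_matrix by blast
qed

theorem theorem2p7:
  fixes n m :: nat and x y :: int
  assumes "n > 0" and "m > 0" and "x \<noteq> 0" and "y \<noteq> 0"
  shows "similar_forms
           (diag_form (vector [of_nat n, (of_int x)\<^sup>2 * of_nat n] :: rat ^ 2))
           (diag_form (vector [of_nat m, (of_int y)\<^sup>2 * of_nat m] :: rat ^ 2))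
         \<longleftrightarrow> r3 n = r3 m"
proof -
  have "similar_forms
           (diag_form (vector [of_nat n, (of_int x)\<^sup>2 * of_nat n] :: rat ^ 2))
           (diag_form (vector [of_nat m, (of_int y)\<^sup>2 * of_nat m] :: rat ^ 2))
        \<longleftrightarrow> (\<exists>u v :: rat. of_nat (n * m) = u\<^sup>2 + v\<^sup>2)"
    using assms similar_forms_iff_sum_squares[of "of_nat n" "of_nat m" "of_int x" "of_int y"]
    by simp
  also have "\<dots> \<longleftrightarrow> r3 n = r3 m"
    using assms rat_sum_squares_iff[of "n * m"] r3_eq_iff[of n m] by simp
  finally show ?thesis .
qed

end
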